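(* Let $r_S$ and $r_T$ be solutions on nonempty sets $S$ and $T$, and let $(r_S,r_T,\alpha,\beta)$ be a matched product system of solutions. Then: (1) there exist integers $l,m\ge 1$ with $r_S^l=\mathrm{id}$ and $r_T^m=\mathrm{id}$ if and only if there exists an integer $n\ge 1$ with $(r_S\bowtie r_T)^n=\mathrm{id}$; (2) there exist integers $l,m\ge 2$ with $r_S^l=r_S$ and $r_T^m=r_T$ if and only if there exists an integer $n\ge 2$ with $(r_S\bowtie r_T)^n=r_S\bowtie r_T$.
   Context: A (set-theoretical) solution on a set $X$ is a map $r:X\times X\to X\times X$ (not necessarily bijective) with $(r\times \mathrm{id}_X)(\mathrm{id}_X\times r)(r\times \mathrm{id}_X)=(\mathrm{id}_X\times r)(r\times \mathrm{id}_X)(\mathrm{id}_X\times r)$. One writes $r(x,y)=(\lambda_x(y),\rho_y(x))$; the same letters $\lambda,\rho$ are used for the component maps of every solution. Powers $r^n$ are iterated compositions. Matched product system: let $r_S$, $r_T$ be solutions on $S$, $T$, and let $\alpha:T\to\mathrm{Sym}(S)$, $\beta:S\to\mathrm{Sym}(T)$ be maps; write $\alpha_u=\alpha(u)$, $\beta_a=\beta(a)$. The quadruple $(r_S,r_T,\alpha,\beta)$ is a matched product system of solutions if for all $a,b\in S$, $u,v\in T$: (s1) $\alpha_u\alpha_v=\alpha_{\lambda_u(v)}\alpha_{\rho_v(u)}$; (s2) $\beta_a\beta_b=\beta_{\lambda_a(b)}\beta_{\rho_b(a)}$; (s3) $\rho_{\alpha_u^{-1}(b)}\alpha^{-1}_{\beta_a(u)}(a)=\alpha^{-1}_{\beta_{\rho_b(a)}\beta_b^{-1}(u)}\rho_b(a)$;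 (s4) $\rho_{\beta_a^{-1}(v)}\beta^{-1}_{\alpha_u(a)}(u)=\beta^{-1}_{\alpha_{\rho_v(u)}\alpha_v^{-1}(a)}\rho_v(u)$; (s5) $\lambda_a\alpha_{\beta_a^{-1}(u)}=\alpha_u\lambda_{\alpha_u^{-1}(a)}$; (s6) $\lambda_u\beta_{\alpha_u^{-1}(a)}=\beta_a\lambda_{\beta_a^{-1}(u)}$. In that case the following map on $(S\times T)\times(S\times T)$ is a solution (known), called the matched product of $r_S$ and $r_T$ and denoted $r_S\bowtie r_T$: $$(r_S\bowtie r_T)((a,u),(b,v))=\Big(\big(A,U\big),\ \big(\alpha^{-1}_{\overline U}\rho_{\alpha_{\bar u}(b)}(a),\ \beta^{-1}_{\overline A}\rho_{\beta_{\bar a}(v)}(u)\big)\Big),$$ where $\bar a=\alpha_u^{-1}(a)$, $\bar u=\beta_a^{-1}(u)$, $A=\alpha_u\lambda_{\bar a}(b)$, $U=\beta_a\lambda_{\bar u}(v)$, $\overline A=\alpha_U^{-1}(A)$, $\overline U=\beta_A^{-1}(U)$. *)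

theory Defs
  imports Main
begin

definition lam :: "('a \<times> 'a \<Rightarrow> 'a \<times> 'a) \<Rightarrow> 'a \<Rightarrow> 'a \<Rightarrow> 'a"
  where "lam r x y = fst (r (x, y))"

text \<open>The subscript comes first: \<open>rho r y x\<close> is \<open>\<rho>\<^sub>y(x)\<close>.\<close>

definition rho :: "('a \<times> 'a \<Rightarrow> 'a \<times> 'a) \<Rightarrow> 'a \<Rightarrow> 'a \<Rightarrow> 'a"
  where "rho r y x = snd (r (x, y))"

text \<open>The maps \<open>r \<times> id\<close> and \<open>id \<times> r\<close> on triples, which are nested to the right.\<close>

definition apply12 :: "('a \<times> 'a \<Rightarrow> 'a \<times> 'a) \<Rightarrow> 'a \<times> 'a \<times> 'a \<Rightarrow> 'a \<times> 'a \<times> 'a"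
  where "apply12 r = (\<lambda>(x, y, z). (fst (r (x, y)), snd (r (x, y)), z))"

definition apply23 :: "('a \<times> 'a \<Rightarrow> 'a \<times> 'a) \<Rightarrow> 'a \<times> 'a \<times> 'a \<Rightarrow> 'a \<times> 'a \<times> 'a"
  where "apply23 r = map_prod id r"

definition ybe_solution :: "('a \<times> 'a \<Rightarrow> 'a \<times> 'a) \<Rightarrow> bool"
  where "ybe_solution r \<longleftrightarrow>
    apply12 r \<circ> apply23 r \<circ> apply12 r = apply23 r \<circ> apply12 r \<circ> apply23 r"

text \<open>The underlying sets are the types \<open>'s\<close> and \<open>'t\<close>; the two bijectivity assumptions say
  that \<open>\<alpha>\<close> and \<open>\<beta>\<close> take values in the symmetric groups.\<close>

locale matched_product_system =
  fixes rS :: "'s \<times> 's \<Rightarrow> 's \<times> 's"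
    and rT :: "'t \<times> 't \<Rightarrow> 't \<times> 't"
    and \<alpha> :: "'t \<Rightarrow> 's \<Rightarrow> 's"
    and \<beta> :: "'s \<Rightarrow> 't \<Rightarrow> 't"
  assumes solution_S: "ybe_solution rS"
    and solution_T: "ybe_solution rT"
    and bij_\<alpha>: "bij (\<alpha> u)"
    and bij_\<beta>: "bij (\<beta> a)"
    and s1: "\<alpha> u \<circ> \<alpha> v = \<alpha> (lam rT u v) \<circ> \<alpha> (rho rT v u)"
    and s2: "\<beta> a \<circ> \<beta> b = \<beta> (lam rS a b) \<circ> \<beta> (rho rS b a)"
    and s3: "rho rS (inv (\<alpha> u) b) (inv (\<alpha> (\<beta> a u)) a) =
      inv (\<alpha> (\<beta> (rho rS b a) (inv (\<beta> b) u))) (rho rS b a)"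
    and s4: "rho rT (inv (\<beta> a) v) (inv (\<beta> (\<alpha> u a)) u) =
      inv (\<beta> (\<alpha> (rho rT v u) (inv (\<alpha> v) a))) (rho rT v u)"
    and s5: "lam rS a \<circ> \<alpha> (inv (\<beta> a) u) = \<alpha> u \<circ> lam rS (inv (\<alpha> u) a)"
    and s6: "lam rT u \<circ> \<beta> (inv (\<alpha> u) a) = \<beta> a \<circ> lam rT (inv (\<beta> a) u)"

text \<open>Below, \<open>a'\<close>, \<open>u'\<close>, \<open>A'\<close>, \<open>U'\<close> are usually written with an overbar.\<close>

definition matched_product ::
  "('s \<times> 's \<Rightarrow> 's \<times> 's) \<Rightarrow> ('t \<times> 't \<Rightarrow> 't \<times> 't) \<Rightarrow> ('t \<Rightarrow> 's \<Rightarrow> 's) \<Rightarrow> ('s \<Rightarrow> 't \<Rightarrow> 't) \<Rightarrow>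
    ('s \<times> 't) \<times> ('s \<times> 't) \<Rightarrow> ('s \<times> 't) \<times> ('s \<times> 't)"
  where "matched_product rS rT \<alpha> \<beta> = (\<lambda>((a, u), (b, v)).
    let a' = inv (\<alpha> u) a;
        u' = inv (\<beta> a) u;
        A = \<alpha> u (lam rS a' b);
        U = \<beta> a (lam rT u' v);
        A' = inv (\<alpha> U) A;
        U' = inv (\<beta> A) U
    in ((A, U),
        (inv (\<alpha> U') (rho rS (\<alpha> u' b) a), inv (\<beta> A') (rho rT (\<beta> a' v) u))))"

end

(* The map ((a, u), (b, v)) \<mapsto> ((a, \<alpha>\<^bsub>u'\<^esub>(b)), (u, \<beta>\<^bsub>a'\<^esub>(v))), with u' = \<beta>\<^sub>a\<^sup>-\<^sup>1(u) and a' = \<alpha>\<^sub>u\<^sup>-\<^sup>1(a), is a bijection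
   from (S \<times> T)\<^sup>2 to S\<^sup>2 \<times> T\<^sup>2. By (s5) and (s6) it conjugates the matched product to the direct product
   r_S \<times> r_T, so an identity between powers of the matched product is the same identity
   between powers of both factors. *)

theory Submission
  imports Defs
begin

lemma funpow_semiconj:
  assumes "h \<circ> f = g \<circ> h"
  shows "h \<circ> f ^^ n = g ^^ n \<circ> h"
proof (induction n)
  case (Suc n)
  have "h \<circ> f ^^ Suc n = (h \<circ> f) \<circ> f ^^ n"
    by (simp add: o_assoc)
  also have "\<dots> = g \<circ> (h \<circ> f ^^ n)"
    by (simp add: assms o_assoc)
  also have "\<dots> = g ^^ Suc n \<circ> h"
    by (simp only: funpow.simps Suc.IH o_assoc)
  finally show ?case .
qed simp

text \<open>Since \<open>h\<close> intertwines all powers, its injectivity cancels it on the left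
  and its surjectivity cancels it on the right.\<close>

lemma funpow_eq_iff_conj:
  assumes "bij h" and "h \<circ> f = g \<circ> h"
  shows "f ^^ n = f ^^ k \<longleftrightarrow> g ^^ n = g ^^ k"
proof -
  have "f ^^ n = f ^^ k \<longleftrightarrow> h \<circ> f ^^ n = h \<circ> f ^^ k"
    using bij_is_inj[OF assms(1)] by (simp add: fun_eq_iff inj_eq)
  also have "\<dots> \<longleftrightarrow> g ^^ n \<circ> h = g ^^ k \<circ> h"
    by (simp add: funpow_semiconj[OF assms(2)])
  also have "\<dots> \<longleftrightarrow> g ^^ n = g ^^ k"
    using bij_is_surj[OF assms(1)] by (metis surj_fun_eq)
  finally show ?thesis .
qed

lemma funpow_map_prod:
  fixes f :: "'a \<Rightarrow> 'a" and g :: "'b \<Rightarrow> 'b"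
  shows "map_prod f g ^^ n = map_prod (f ^^ n) (g ^^ n)"
  by (induction n) (auto simp: fun_eq_iff)

text \<open>Each factor is recovered by pairing its argument with an arbitrary element of the other
  type. Nonemptiness of S and T enters here, through the fact that every type is inhabited.\<close>

lemma map_prod_eq_iff: "map_prod f g = map_prod f' g' \<longleftrightarrow> f = f' \<and> g = g'"
  by (auto simp: fun_eq_iff)

lemma funpow_mult_eq_id:
  fixes f :: "'a \<Rightarrow> 'a"
  assumes "f ^^ n = id"
  shows "f ^^ (n * k) = id"
  by (simp add: funpow_mult[symmetric] assms)

text \<open>Without injectivity \<open>f ^^ p = id\<close> does not follow, so one factor
  \<open>f\<close> is kept to absorb each block \<open>f ^^ p\<close>. This makes exponents of the
  form 1 plus a multiple of \<open>p\<close> available.\<close>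

lemma funpow_Suc_mult_eq:
  fixes f :: "'a \<Rightarrow> 'a"
  assumes "f ^^ Suc p = f"
  shows "f ^^ Suc (p * k) = f"
proof (induction k)
  case (Suc k)
  have "f ^^ Suc (p * Suc k) = f ^^ Suc (p * k) \<circ> f ^^ p"
    by (metis add.commute add_Suc funpow_add mult_Suc_right)
  also have "\<dots> = f"
    unfolding Suc.IH using assms by simp
  finally show ?case .
qed simp

definition untwist :: "('t \<Rightarrow> 's \<Rightarrow> 's) \<Rightarrow> ('s \<Rightarrow> 't \<Rightarrow> 't) \<Rightarrow>
    ('s \<times> 't) \<times> ('s \<times> 't) \<Rightarrow> ('s \<times> 's) \<times> ('t \<times> 't)"
  where "untwist \<alpha> \<beta> = (\<lambda>((a, u), (b, v)).
    ((a, \<alpha> (inv (\<beta> a) u) b), (u, \<beta> (inv (\<alpha> u) a) v)))"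

context matched_product_system
begin

text \<open>The entries \<open>a\<close> and \<open>u\<close> pass through unchanged and determine
  the two permutations applied to \<open>b\<close> and \<open>v\<close>, which can therefore be
  undone.\<close>

lemma bij_untwist: "bij (untwist \<alpha> \<beta>)"
proof (rule bijI)
  show "inj (untwist \<alpha> \<beta>)"
    by (auto simp: inj_def untwist_def inj_eq[OF bij_is_inj[OF bij_\<alpha>]]
        inj_eq[OF bij_is_inj[OF bij_\<beta>]])
  show "surj (untwist \<alpha> \<beta>)"
  proof (rule surjI)
    fix y
    show "untwist \<alpha> \<beta> ((\<lambda>((a, c), (u, w)).
        ((a, u), (inv (\<alpha> (inv (\<beta> a) u)) c, inv (\<beta> (inv (\<alpha> u) a)) w))) y) = y"
      by (simp add: untwist_def surj_f_inv_f bij_is_surj bij_\<alpha> bij_\<beta> split: prod.split)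
  qed
qed

text \<open>The inverse permutations in the second pair of the matched product are indexed by the
  barred output entries, exactly those that \<open>untwist\<close> applies next, so they
  cancel.\<close>

lemma untwist_matched_product:
  "untwist \<alpha> \<beta> \<circ> matched_product rS rT \<alpha> \<beta> = map_prod rS rT \<circ> untwist \<alpha> \<beta>"
proof
  fix x :: "('s \<times> 't) \<times> ('s \<times> 't)"
  obtain a u b v where x: "x = ((a, u), (b, v))"
    by (metis surj_pair)
  have A: "\<alpha> u (lam rS (inv (\<alpha> u) a) b) = lam rS a (\<alpha> (inv (\<beta> a) u) b)"
    using fun_cong[OF s5[of a u], of b] by simp
  have U: "\<beta> a (lam rT (inv (\<beta> a) u) v) = lam rT u (\<beta> (inv (\<alpha> u) a) v)"
    using fun_cong[OF s6[of u a], of v] by simp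
  show "(untwist \<alpha> \<beta> \<circ> matched_product rS rT \<alpha> \<beta>) x = (map_prod rS rT \<circ> untwist \<alpha> \<beta>) x"
    by (simp add: x untwist_def matched_product_def Let_def A U
        surj_f_inv_f bij_is_surj bij_\<alpha> bij_\<beta>) (simp add: lam_def rho_def)
qed

text \<open>Both parts of the theorem are instances: \<open>k = 0\<close> compares with the
  identity, \<open>k = 1\<close> with the map itself.\<close>

lemma funpow_matched_product_eq_iff:
  "matched_product rS rT \<alpha> \<beta> ^^ n = matched_product rS rT \<alpha> \<beta> ^^ k \<longleftrightarrow>
    rS ^^ n = rS ^^ k \<and> rT ^^ n = rT ^^ k"
  by (simp add: funpow_eq_iff_conj[OF bij_untwist untwist_matched_product]
      funpow_map_prod map_prod_eq_iff)

end

theorem corollary11: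
  fixes rS :: "'s \<times> 's \<Rightarrow> 's \<times> 's"
    and rT :: "'t \<times> 't \<Rightarrow> 't \<times> 't"
    and \<alpha> :: "'t \<Rightarrow> 's \<Rightarrow> 's"
    and \<beta> :: "'s \<Rightarrow> 't \<Rightarrow> 't"
  assumes "matched_product_system rS rT \<alpha> \<beta>"
  shows "((\<exists>l\<ge>1. \<exists>m\<ge>1. rS ^^ l = id \<and> rT ^^ m = id) \<longleftrightarrow>
          (\<exists>n\<ge>1. matched_product rS rT \<alpha> \<beta> ^^ n = id)) \<and>
         ((\<exists>l\<ge>2. \<exists>m\<ge>2. rS ^^ l = rS \<and> rT ^^ m = rT) \<longleftrightarrow>
          (\<exists>n\<ge>2. matched_product rS rT \<alpha> \<beta> ^^ n = matched_product rS rT \<alpha> \<beta>))"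
proof -
  interpret matched_product_system rS rT \<alpha> \<beta>
    by (fact assms)
  let ?r = "matched_product rS rT \<alpha> \<beta>"
  have id_iff: "?r ^^ n = id \<longleftrightarrow> rS ^^ n = id \<and> rT ^^ n = id" for n
    using funpow_matched_product_eq_iff[of n 0] by simp
  have self_iff: "?r ^^ n = ?r \<longleftrightarrow> rS ^^ n = rS \<and> rT ^^ n = rT" for n
    using funpow_matched_product_eq_iff[of n 1] by simp
  have "\<exists>n\<ge>1. ?r ^^ n = id" if "l \<ge> 1" "m \<ge> 1" "rS ^^ l = id" "rT ^^ m = id" for l m
  proof (intro exI conjI)
    show "l * m \<ge> 1"
      using that by simp
    show "?r ^^ (l * m) = id"
      using funpow_mult_eq_id[OF that(3), of m] funpow_mult_eq_id[OF that(4), of l]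
      by (simp add: id_iff mult.commute)
  qed
  moreover have "\<exists>n\<ge>2. ?r ^^ n = ?r"
    if "l \<ge> 2" "m \<ge> 2" "rS ^^ l = rS" "rT ^^ m = rT" for l m
  proof -
    \<comment> \<open>The number that can be added repeatedly to an exponent is \<open>l - 1\<close>
      for \<open>rS\<close> and \<open>m - 1\<close> for \<open>rT\<close>, so 1 plus the product of
      the two serves both maps.\<close>
    obtain p q where l: "l = Suc p" and m: "m = Suc q"
      using \<open>l \<ge> 2\<close> \<open>m \<ge> 2\<close> by (metis Suc_le_D numeral_2_eq_2)
    show ?thesis
    proof (intro exI conjI)
      show "Suc (p * q) \<ge> 2"
        using that by (simp add: l m)
      show "?r ^^ Suc (p * q) = ?r"
        using funpow_Suc_mult_eq[OF that(3)[unfolded l], of q]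
          funpow_Suc_mult_eq[OF that(4)[unfolded m], of p]
        by (simp only: self_iff mult.commute[of q p])
    qed
  qed
  \<comment> \<open>The implications from the matched product to its factors take
    \<open>l = m = n\<close>.\<close>
  ultimately show ?thesis
    unfolding id_iff self_iff by blast
qed

end
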